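(* Let $p$ be a proper element of $L$ and $b\in L$. Then the following statements are equivalent: (1) $b$ is $\phi$-$\delta$-primary to $p$. (2) Either $(p:b)\leqslant \delta(p)$ or $(p:b)=(\phi(p):b)$. (3) For every $r\in L_\ast$, $rb\leqslant p$ and $rb\not\leqslant \phi(p)$ implies $r\leqslant \delta(p)$.
   Context: A multiplicative lattice is a complete lattice (least element $0$, largest element $1$) with a commutative, associative multiplication that distributes over arbitrary joins and has $1$ as multiplicative identity. An element $a$ is compact if whenever $a\leqslant \vee X$ for $X\subseteq L$ there are finitely many $a_1,\dots,a_n\in X$ with $a\leqslant a_1\vee\cdots\vee a_n$; $L_\ast$ is the set of compact elements. Standing assumptions: $L$ is a compactly generated multiplicative lattice (every element is a join of compact elements), $1$ is compact, and every finite product of compact elements is compact. An element $p$ is proper if $p<1$. For $a,b\in L$, $(a:b)=\vee\{x\in L\mid xb\leqslant a\}$. $\delta:L\to L$ is an expansion function: $a\leqslant\delta(a)$ for all $a$, and $a\leqslant b$ implies $\delta(a)\leqslant\delta(b)$. $\phi:L\to L$ is a function, assumed to satisfy $\phi(q)\leqslant q$ for all $q\in L$. An element $b\in L$ is $\phi$-$\delta$-primary to a proper element $p\in L$ if for all $x\in L$, $xb\leqslant p$ and $xb\not\leqslant\phi(p)$ implies $x\leqslant\delta(p)$. *)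

theory Defs
  imports Main
begin

class multiplicative_lattice = complete_lattice + comm_monoid_mult +
  assumes mult_Sup_distrib: "x * Sup A = Sup ((\<lambda>y. x * y) ` A)"
    and one_eq_top: "1 = top"

text \<open>The finite set \<open>F\<close> may be empty: this is the convention under which the least
  element is compact, since it lies below the join of the empty set.\<close>

definition (in complete_lattice) compact_element :: "'a \<Rightarrow> bool"
  where "compact_element a \<longleftrightarrow>
    (\<forall>X. a \<le> Sup X \<longrightarrow> (\<exists>F. finite F \<and> F \<subseteq> X \<and> a \<le> Sup F))"

definition (in complete_lattice) compact_elements :: "'a set"
  where "compact_elements = {a. compact_element a}"

text \<open>The last two axioms together say that all finite products of compact elements,
  including the empty one, are compact.\<close>

class compactly_generated_multiplicative_lattice = multiplicative_lattice +
  assumes compactly_generated: "\<exists>X \<subseteq> compact_elements. a = Sup X"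
    and compact_one: "1 \<in> compact_elements"
    and compact_mult:
      "a \<in> compact_elements \<Longrightarrow> b \<in> compact_elements \<Longrightarrow> a * b \<in> compact_elements"

definition proper_element :: "'a::multiplicative_lattice \<Rightarrow> bool"
  where "proper_element p \<longleftrightarrow> p < 1"

definition residual :: "'a::multiplicative_lattice \<Rightarrow> 'a \<Rightarrow> 'a"
  where "residual a b = Sup {x. x * b \<le> a}"

definition expansion_function :: "('a::multiplicative_lattice \<Rightarrow> 'a) \<Rightarrow> bool"
  where "expansion_function \<delta> \<longleftrightarrow>
    (\<forall>a. a \<le> \<delta> a) \<and> (\<forall>a b. a \<le> b \<longrightarrow> \<delta> a \<le> \<delta> b)"

text \<open>\<open>primary_to \<phi> \<delta> b p\<close>: the element \<open>b\<close> is \<open>\<phi>\<close>-\<open>\<delta>\<close>-primary to \<open>p\<close>. The notion is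
  only meant for proper \<open>p\<close>; properness is not part of the predicate.\<close>

definition primary_to ::
    "('a::multiplicative_lattice \<Rightarrow> 'a) \<Rightarrow> ('a \<Rightarrow> 'a) \<Rightarrow> 'a \<Rightarrow> 'a \<Rightarrow> bool"
  where "primary_to \<phi> \<delta> b p \<longleftrightarrow>
    (\<forall>x. x * b \<le> p \<and> \<not> x * b \<le> \<phi> p \<longrightarrow> x \<le> \<delta> p)"

end

theory Submission
  imports Defs
begin

text \<open>Multiplication by \<open>b\<close> is left adjoint to the residual by \<open>b\<close>, so \<open>residual p b\<close> is the
  largest \<open>x\<close> with \<open>x * b \<le> p\<close>, and testing the primary condition on this one element gives
  the dichotomy. For the reduction to compact elements, let \<open>x\<close> be a join of compact elements
  with \<open>x * b \<le> p\<close> and \<open>\<not> x * b \<le> \<phi> p\<close>. Some compact \<open>r\<close> in the join already satisfies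
  \<open>\<not> r * b \<le> \<phi> p\<close>, and so does \<open>sup r s\<close> for every other compact \<open>s\<close> in it; hence each \<open>s\<close>
  lies below \<open>\<delta> p\<close>.\<close>

lemma Sup_mult_le_iff:
  fixes b c :: "'a::multiplicative_lattice"
  shows "Sup X * b \<le> c \<longleftrightarrow> (\<forall>x\<in>X. x * b \<le> c)"
proof -
  have "Sup X * b = (SUP x\<in>X. x * b)"
    using mult_Sup_distrib[of b X] by (simp add: mult.commute)
  then show ?thesis
    by (simp add: SUP_le_iff)
qed

lemma sup_mult_le_iff:
  fixes b c :: "'a::multiplicative_lattice"
  shows "sup x y * b \<le> c \<longleftrightarrow> x * b \<le> c \<and> y * b \<le> c"
  using Sup_mult_le_iff[of "{x, y}" b c] by simp

lemma le_residual_iff: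
  fixes a b x :: "'a::multiplicative_lattice"
  shows "x \<le> residual a b \<longleftrightarrow> x * b \<le> a"
proof
  assume "x \<le> residual a b"
  \<comment> \<open>Monotonicity of multiplication comes from distributivity: once the larger
    element is written as a join with \<open>x\<close>, a bound on its product with \<open>b\<close>
    passes to \<open>x * b\<close>.\<close>
  then have "sup x (residual a b) = residual a b"
    by (rule sup_absorb2)
  moreover have "residual a b * b \<le> a"
    by (simp add: residual_def Sup_mult_le_iff)
  ultimately show "x * b \<le> a"
    using sup_mult_le_iff[of x "residual a b" b a] by simp
next
  assume "x * b \<le> a"
  then show "x \<le> residual a b"
    by (simp add: residual_def Sup_upper)
qed

lemma residual_mono:
  fixes a c b :: "'a::multiplicative_lattice"
  shows "a \<le> c \<Longrightarrow> residual a b \<le> residual c b"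
  by (meson le_residual_iff order.refl order.trans)

text \<open>The union of finite subcovers for \<open>r\<close> and \<open>s\<close> covers their
  join.\<close>

lemma compact_elements_sup:
  fixes r s :: "'a::complete_lattice"
  assumes "r \<in> compact_elements" and "s \<in> compact_elements"
  shows "sup r s \<in> compact_elements"
  unfolding compact_elements_def compact_element_def mem_Collect_eq
proof (intro allI impI)
  fix X :: "'a set"
  assume "sup r s \<le> Sup X"
  then have "r \<le> Sup X" and "s \<le> Sup X"
    by simp_all
  then obtain F G where "finite F" "F \<subseteq> X" "r \<le> Sup F" "finite G" "G \<subseteq> X" "s \<le> Sup G"
    using assms unfolding compact_elements_def compact_element_def by blast
  then show "\<exists>F. finite F \<and> F \<subseteq> X \<and> sup r s \<le> Sup F"
    by (intro exI[of _ "F \<union> G"]) (simp add: Sup_union_distrib le_supI1 le_supI2)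
qed

lemma primary_to_iff_residual:
  fixes p b :: "'a::multiplicative_lattice"
  assumes "\<phi> p \<le> p"
  shows "primary_to \<phi> \<delta> b p \<longleftrightarrow>
    residual p b \<le> \<delta> p \<or> residual p b = residual (\<phi> p) b"
proof
  assume primary: "primary_to \<phi> \<delta> b p"
  have "residual p b \<le> \<delta> p" if "\<not> residual p b \<le> residual (\<phi> p) b"
    using primary that le_residual_iff[of "residual p b"]
    unfolding primary_to_def by blast
  then show "residual p b \<le> \<delta> p \<or> residual p b = residual (\<phi> p) b"
    \<comment> \<open>The bound \<open>\<phi> p \<le> p\<close> supplies the reverse inequality,
      hence equality.\<close>
    using residual_mono[OF assms] by (blast intro: order.antisym)
next
  assume "residual p b \<le> \<delta> p \<or> residual p b = residual (\<phi> p) b"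
  then show "primary_to \<phi> \<delta> b p"
    \<comment> \<open>In residual form, equal residuals make the two conditions on \<open>x\<close>
      contradictory.\<close>
    unfolding primary_to_def le_residual_iff[symmetric] by (auto intro: order.trans)
qed

lemma primary_to_iff_compact:
  fixes p b :: "'a::compactly_generated_multiplicative_lattice"
  shows "primary_to \<phi> \<delta> b p \<longleftrightarrow>
    (\<forall>r \<in> compact_elements. r * b \<le> p \<and> \<not> r * b \<le> \<phi> p \<longrightarrow> r \<le> \<delta> p)"
proof
  assume "primary_to \<phi> \<delta> b p"
  then show "\<forall>r \<in> compact_elements. r * b \<le> p \<and> \<not> r * b \<le> \<phi> p \<longrightarrow> r \<le> \<delta> p"
    unfolding primary_to_def by blast
next
  assume compact: "\<forall>r \<in> compact_elements. r * b \<le> p \<and> \<not> r * b \<le> \<phi> p \<longrightarrow> r \<le> \<delta> p"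
  show "primary_to \<phi> \<delta> b p"
    unfolding primary_to_def
  proof (intro allI impI)
    fix x
    assume x: "x * b \<le> p \<and> \<not> x * b \<le> \<phi> p"
    obtain X where X: "X \<subseteq> compact_elements" "x = Sup X"
      using compactly_generated by blast
    then have le_p: "s * b \<le> p" if "s \<in> X" for s
      using x that by (simp add: Sup_mult_le_iff)
    \<comment> \<open>Otherwise distributivity would give \<open>x * b \<le> \<phi> p\<close>; this
      also covers empty \<open>X\<close>.\<close>
    obtain r where r: "r \<in> X" "\<not> r * b \<le> \<phi> p"
      using x X by (auto simp: Sup_mult_le_iff)
    \<comment> \<open>Since \<open>s * b \<le> \<phi> p\<close> is possible, the hypothesis may not
      apply to \<open>s\<close> alone.\<close>
    have "s \<le> \<delta> p" if "s \<in> X" for s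
    proof -
      have "sup r s \<in> compact_elements"
        using X r that by (blast intro: compact_elements_sup)
      moreover have "sup r s * b \<le> p" and "\<not> sup r s * b \<le> \<phi> p"
        using r that le_p by (simp_all add: sup_mult_le_iff)
      ultimately have "sup r s \<le> \<delta> p"
        using compact by blast
      then show ?thesis
        by simp
    qed
    then show "x \<le> \<delta> p"
      using X by (simp add: Sup_le_iff)
  qed
qed

theorem theorem2p9:
  fixes p b :: "'a::compactly_generated_multiplicative_lattice"
    and \<phi> \<delta> :: "'a \<Rightarrow> 'a"
  assumes "expansion_function \<delta>"
    and "\<And>q. \<phi> q \<le> q"
    and "proper_element p"
  shows "(primary_to \<phi> \<delta> b p \<longleftrightarrow>
            residual p b \<le> \<delta> p \<or> residual p b = residual (\<phi> p) b)
       \<and> (primary_to \<phi> \<delta> b p \<longleftrightarrow>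
            (\<forall>r \<in> compact_elements. r * b \<le> p \<and> \<not> r * b \<le> \<phi> p \<longrightarrow> r \<le> \<delta> p))"
  using primary_to_iff_residual[of \<phi> p, OF assms(2)] primary_to_iff_compact by blast

end
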